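(* There exists an absolute constant $C>0$ such that the following holds. Let $1\le r\le m\le n$ be integers and $k>0$. Let $Y\in\mathbb{R}^{m\times n}$ be a rank-$r$ matrix, let $E\in\mathbb{R}^{m\times n}$ be an arbitrary fixed (adversarial) noise matrix, and let $\widehat{Y}=Y+E$, where all entries of $Y$ and of $\widehat{Y}$ lie in $[-k,k]$. Let $\Omega\subseteq\{1,\dots,m\}\times\{1,\dots,n\}$ be a sampling set of given nonzero cardinality $|\Omega|$ chosen uniformly at random, and let $Y^*=U^*V^{*T}$, where $(U^*,V^* )$ is a global optimal solution of $$\min_{U\in\mathbb{R}^{m\times r},\,V\in\mathbb{R}^{n\times r}}\ \frac12\left\|P_\Omega(UV^T-\widehat{Y})\right\|_F^2\quad\text{subject to}\quad \left|[UV^T]_{i,j}\right|\le k\ \text{ for all } i,j.$$ Then, with probability at least $1-2\exp(-n)$ (over the choice of $\Omega$), $$\frac{1}{\sqrt{mn}}\|Y^*-Y\|_F\ \le\ \frac{1}{\sqrt{|\Omega|}}\|P_\Omega(E)\|_F+\frac{\|E\|_F}{\sqrt{mn}}+Ck\left(\frac{nr\log(n)}{|\Omega|}\right)^{\frac14}.$$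
   Context: $\|\cdot\|_F$ is the Frobenius norm. The sampling operator $P_\Omega$ is defined by $[P_\Omega(X)]_{i,j}=X_{i,j}$ if $(i,j)\in\Omega$ and $0$ otherwise. The sampling of $\Omega$ is uniform without replacement, i.e. $\Omega$ is uniformly distributed over all subsets of $\{1,\dots,m\}\times\{1,\dots,n\}$ of the given cardinality. The quantity $\frac{1}{\sqrt{mn}}\|Y^*-Y\|_F$ is the root mean square error (RMSE). *)

theory Defs
  imports
    "HOL-Probability.Probability"
    "Jordan_Normal_Form.DL_Rank"
begin

text \<open>
  Matrices carry explicit dimensions because the constant in the theorem must not depend on them.
  Rows and columns are indexed from 0, so the index set is \<open>{..<m} \<times> {..<n}\<close>.
\<close>

definition frob_norm :: "real mat \<Rightarrow> real" where
  "frob_norm A = sqrt (\<Sum>i<dim_row A. \<Sum>j<dim_col A. (A $$ (i, j))\<^sup>2)"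

definition samp :: "(nat \<times> nat) set \<Rightarrow> real mat \<Rightarrow> real mat" where
  "samp \<Omega> X = mat (dim_row X) (dim_col X) (\<lambda>ij. if ij \<in> \<Omega> then X $$ ij else 0)"

definition entries_bounded :: "real \<Rightarrow> real mat \<Rightarrow> bool" where
  "entries_bounded k A \<longleftrightarrow> (\<forall>i<dim_row A. \<forall>j<dim_col A. \<bar>A $$ (i, j)\<bar> \<le> k)"

definition mf_feasible :: "nat \<Rightarrow> nat \<Rightarrow> nat \<Rightarrow> real \<Rightarrow> real mat \<times> real mat \<Rightarrow> bool" where
  "mf_feasible m n r k = (\<lambda>(U, V).
     U \<in> carrier_mat m r \<and> V \<in> carrier_mat n r \<and> entries_bounded k (U * transpose_mat V))"

definition mf_objective :: "(nat \<times> nat) set \<Rightarrow> real mat \<Rightarrow> real mat \<times> real mat \<Rightarrow> real" where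
  "mf_objective \<Omega> Yhat = (\<lambda>(U, V). 1 / 2 * (frob_norm (samp \<Omega> (U * transpose_mat V - Yhat)))\<^sup>2)"

definition uniform_samples :: "nat \<Rightarrow> nat \<Rightarrow> nat \<Rightarrow> (nat \<times> nat) set pmf" where
  "uniform_samples m n s = pmf_of_set {\<Omega>. \<Omega> \<subseteq> {..<m} \<times> {..<n} \<and> card \<Omega> = s}"

end

theory Submission
  imports Defs "Jordan_Normal_Form.Char_Poly"
begin

text \<open>
  Let \<open>Z = Y + E\<close>. Since \<open>Y\<close> is itself feasible, optimality gives
  \<open>\<parallel>P_\<Omega> (Y* - Z)\<parallel> \<le> \<parallel>P_\<Omega> E\<parallel>\<close>, so it suffices that, uniformly over all feasible \<open>X\<close>, the root
  mean square of \<open>X - Z\<close> exceeds that over the sample by at most \<open>C k (n r log n / s)^(1/4)\<close>. For one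
  fixed \<open>X\<close> the sample mean of the squared entries is controlled by a Chernoff bound for sampling
  without replacement. For the union bound, the feasible matrices are covered by \<open>n^(8 n r)\<close> sup-norm
  balls of radius \<open>O(k / n)\<close>: choosing \<open>r\<close> rows of maximal volume writes \<open>X\<close> (up to a small
  perturbation) as \<open>W R\<close> where \<open>W\<close> has entries in \<open>[-1, 1]\<close> and \<open>R\<close> consists of rows of \<open>X\<close>, and both
  factors are rounded entrywise.
\<close>

section \<open>Sampling without replacement\<close>

text \<open>The elementary symmetric polynomial of degree \<open>s\<close>. Divided by
  \<open>card A choose s\<close> it is the expected product of \<open>a\<close> over a uniformly
  drawn \<open>s\<close>-subset, which is its link to sampling.\<close>

definition esym :: "nat \<Rightarrow> 'a set \<Rightarrow> ('a \<Rightarrow> real) \<Rightarrow> real" where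
  "esym s A a = (\<Sum>\<Omega> | \<Omega> \<subseteq> A \<and> card \<Omega> = s. \<Prod>i\<in>\<Omega>. a i)"

lemma esym_0: "finite A \<Longrightarrow> esym 0 A a = 1"
proof -
  assume "finite A"
  then have "{\<Omega>. \<Omega> \<subseteq> A \<and> card \<Omega> = 0} = {{}}"
    by (auto dest: finite_subset)
  then show ?thesis by (simp add: esym_def)
qed

lemma esym_nonneg: "(\<And>i. i \<in> A \<Longrightarrow> a i \<ge> 0) \<Longrightarrow> esym s A a \<ge> 0"
  unfolding esym_def by (intro sum_nonneg prod_nonneg) auto

text \<open>Subsets of size \<open>Suc s\<close> split by whether they contain \<open>x\<close>: a
  weighted Pascal rule.\<close>

lemma esym_insert:
  assumes "finite A" "x \<notin> A"
  shows "esym (Suc s) (insert x A) a = esym (Suc s) A a + a x * esym s A a"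
proof -
  have eq: "{\<Omega>. \<Omega> \<subseteq> insert x A \<and> card \<Omega> = Suc s} =
      {\<Omega>. \<Omega> \<subseteq> A \<and> card \<Omega> = Suc s} \<union> insert x ` {\<Omega>. \<Omega> \<subseteq> A \<and> card \<Omega> = s}" (is "?L = ?R")
  proof
    show "?R \<subseteq> ?L"
      using assms by (auto simp: card_insert_if finite_subset subset_iff)
    show "?L \<subseteq> ?R"
    proof
      fix \<Omega> assume *: "\<Omega> \<in> ?L"
      show "\<Omega> \<in> ?R"
      proof (cases "x \<in> \<Omega>")
        case True
        then have "\<Omega> = insert x (\<Omega> - {x})" "\<Omega> - {x} \<subseteq> A" "card (\<Omega> - {x}) = s" using * by auto
        then show ?thesis by blast
      qed (use * in auto)
    qed
  qed
  have inj: "inj_on (insert x) {\<Omega>. \<Omega> \<subseteq> A \<and> card \<Omega> = s}"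
    using assms(2) by (auto intro!: inj_onI)
  have "esym (Suc s) (insert x A) a = esym (Suc s) A a
      + (\<Sum>\<Omega>\<in>insert x ` {\<Omega>. \<Omega> \<subseteq> A \<and> card \<Omega> = s}. \<Prod>i\<in>\<Omega>. a i)"
    unfolding esym_def eq using assms by (intro sum.union_disjoint) auto
  also have "(\<Sum>\<Omega>\<in>insert x ` {\<Omega>. \<Omega> \<subseteq> A \<and> card \<Omega> = s}. \<Prod>i\<in>\<Omega>. a i)
      = (\<Sum>\<Omega> | \<Omega> \<subseteq> A \<and> card \<Omega> = s. a x * (\<Prod>i\<in>\<Omega>. a i))"
    unfolding sum.reindex[OF inj]
  proof (rule sum.cong)
    fix \<Omega> assume "\<Omega> \<in> {\<Omega>. \<Omega> \<subseteq> A \<and> card \<Omega> = s}"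
    then have "finite \<Omega>" "x \<notin> \<Omega>" using assms finite_subset by auto
    then show "((\<lambda>\<Omega>. \<Prod>i\<in>\<Omega>. a i) \<circ> insert x) \<Omega> = a x * (\<Prod>i\<in>\<Omega>. a i)" by simp
  qed simp
  finally show ?thesis by (simp add: esym_def sum_distrib_left)
qed

text \<open>Double counting: an \<open>s\<close>-subset survives the removal of \<open>i\<close>
  exactly when it avoids \<open>i\<close>, which happens for \<open>card A - s\<close>
  indices.\<close>

lemma sum_esym_remove:
  assumes "finite A" "s \<le> card A"
  shows "(\<Sum>i\<in>A. esym s (A - {i}) a) = (real (card A) - real s) * esym s A a"
proof -
  let ?S = "{\<Omega>. \<Omega> \<subseteq> A \<and> card \<Omega> = s}"
  have fS: "finite ?S" using assms by auto
  have "esym s (A - {i}) a = (\<Sum>\<Omega>\<in>?S. if i \<notin> \<Omega> then \<Prod>j\<in>\<Omega>. a j else 0)" for i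
  proof -
    have "(\<Sum>\<Omega>\<in>?S. if i \<notin> \<Omega> then \<Prod>j\<in>\<Omega>. a j else 0) = (\<Sum>\<Omega>\<in>{\<Omega>\<in>?S. i \<notin> \<Omega>}. \<Prod>j\<in>\<Omega>. a j)"
      by (rule sum.inter_filter[OF fS, symmetric])
    also have "{\<Omega>\<in>?S. i \<notin> \<Omega>} = {\<Omega>. \<Omega> \<subseteq> A - {i} \<and> card \<Omega> = s}" by auto
    finally show ?thesis by (simp add: esym_def)
  qed
  then have "(\<Sum>i\<in>A. esym s (A - {i}) a) = (\<Sum>\<Omega>\<in>?S. \<Sum>i\<in>A. if i \<notin> \<Omega> then \<Prod>j\<in>\<Omega>. a j else 0)"
    by (simp add: sum.swap[of _ ?S])
  also have "\<dots> = (\<Sum>\<Omega>\<in>?S. (real (card A) - real s) * (\<Prod>j\<in>\<Omega>. a j))"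
  proof (rule sum.cong)
    fix \<Omega> assume \<Omega>: "\<Omega> \<in> ?S"
    then have f: "finite \<Omega>" using assms finite_subset by auto
    have "(\<Sum>i\<in>A. if i \<notin> \<Omega> then \<Prod>j\<in>\<Omega>. a j else 0) = (\<Sum>i\<in>{i\<in>A. i \<notin> \<Omega>}. \<Prod>j\<in>\<Omega>. a j)"
      by (rule sum.inter_filter[OF assms(1), symmetric])
    also have "{i\<in>A. i \<notin> \<Omega>} = A - \<Omega>" by auto
    also have "(\<Sum>i\<in>A - \<Omega>. \<Prod>j\<in>\<Omega>. a j) = real (card (A - \<Omega>)) * (\<Prod>j\<in>\<Omega>. a j)" by simp
    also have "card (A - \<Omega>) = card A - s" using \<Omega> f by (simp add: card_Diff_subset)
    finally show "(\<Sum>i\<in>A. if i \<notin> \<Omega> then \<Prod>j\<in>\<Omega>. a j else 0) = (real (card A) - real s) * (\<Prod>j\<in>\<Omega>. a j)"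
      using assms(2) by (simp add: of_nat_diff)
  qed simp
  finally show ?thesis by (simp add: esym_def sum_distrib_left)
qed

text \<open>By \<open>esym_insert\<close> each summand is what removing \<open>i\<close> takes away
  from \<open>esym (Suc s) A a\<close>, and every product of \<open>Suc s\<close> factors is lost
  once per factor.\<close>

lemma sum_mult_esym_remove:
  assumes "finite A" "Suc s \<le> card A"
  shows "(\<Sum>i\<in>A. a i * esym s (A - {i}) a) = real (Suc s) * esym (Suc s) A a"
proof -
  have "a i * esym s (A - {i}) a = esym (Suc s) A a - esym (Suc s) (A - {i}) a" if "i \<in> A" for i
    using esym_insert[of "A - {i}" i s a] that assms(1) by (simp add: insert_absorb)
  then have "(\<Sum>i\<in>A. a i * esym s (A - {i}) a)
      = (\<Sum>i\<in>A. esym (Suc s) A a - esym (Suc s) (A - {i}) a)" by simp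
  also have "\<dots> = real (Suc s) * esym (Suc s) A a"
    using sum_esym_remove[OF assms, of a] by (simp add: sum_subtractf algebra_simps)
  finally show ?thesis .
qed

text \<open>With both \<open>i\<close> and \<open>j\<close> taken out, the two sides differ only in
  whether \<open>a i\<close> or \<open>a j\<close> multiplies the same nonnegative quantity.\<close>

lemma esym_remove_antimono:
  assumes "finite A" "\<And>i. i \<in> A \<Longrightarrow> a i \<ge> 0" "i \<in> A" "j \<in> A" "a i \<le> a j"
  shows "esym s (A - {j}) a \<le> esym s (A - {i}) a"
proof (cases "i = j \<or> s = 0")
  case True
  then show ?thesis using assms(1) by (auto simp: esym_0)
next
  case False
  then obtain t where s: "s = Suc t" by (cases s) auto
  let ?B = "A - {i} - {j}"
  have i: "insert i ?B = A - {j}" and j: "insert j ?B = A - {i}" using False assms by auto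
  have "esym s (A - {j}) a = esym s ?B a + a i * esym t ?B a"
    using esym_insert[of ?B i t a] assms(1) unfolding i s by simp
  moreover have "esym s (A - {i}) a = esym s ?B a + a j * esym t ?B a"
    using esym_insert[of ?B j t a] assms(1) unfolding j s by simp
  moreover have "esym t ?B a \<ge> 0" using assms(2) by (intro esym_nonneg) auto
  then have "a i * esym t ?B a \<le> a j * esym t ?B a" using assms(5) by (intro mult_right_mono)
  ultimately show ?thesis by linarith
qed

text \<open>Opposite ordering makes every product \<open>(f i - f j) * (g i - g j)\<close>
  nonpositive; summing over all pairs and expanding gives the claim.\<close>

lemma Chebyshev_sum_opposite:
  fixes f g :: "'a \<Rightarrow> real"
  assumes "\<And>i j. i \<in> A \<Longrightarrow> j \<in> A \<Longrightarrow> f i \<le> f j \<Longrightarrow> g j \<le> g i"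
  shows "real (card A) * (\<Sum>i\<in>A. f i * g i) \<le> sum f A * sum g A"
proof -
  have "(f i - f j) * (g i - g j) \<le> 0" if "i \<in> A" "j \<in> A" for i j
    using assms[of i j] assms[of j i] that
    by (cases "f i \<le> f j") (auto simp: mult_le_0_iff)
  then have "(\<Sum>i\<in>A. \<Sum>j\<in>A. (f i - f j) * (g i - g j)) \<le> 0" by (intro sum_nonpos) auto
  also have "(\<Sum>i\<in>A. \<Sum>j\<in>A. (f i - f j) * (g i - g j))
      = (\<Sum>i\<in>A. \<Sum>j\<in>A. f i * g i) - (\<Sum>i\<in>A. \<Sum>j\<in>A. f i * g j)
        - (\<Sum>i\<in>A. \<Sum>j\<in>A. f j * g i) + (\<Sum>i\<in>A. \<Sum>j\<in>A. f j * g j)"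
    by (simp add: algebra_simps sum.distrib sum_subtractf)
  also have "(\<Sum>i\<in>A. \<Sum>j\<in>A. f i * g j) = sum f A * sum g A" by (simp add: sum_product)
  also have "(\<Sum>i\<in>A. \<Sum>j\<in>A. f j * g i) = sum f A * sum g A"
    by (subst sum.swap) (simp add: sum_product)
  finally have "2 * (real (card A) * (\<Sum>i\<in>A. f i * g i)) \<le> 2 * (sum f A * sum g A)"
    by (simp add: sum_distrib_left[symmetric])
  then show ?thesis by simp
qed

text \<open>
  The induction step is Chebyshev's sum inequality: \<open>a i\<close> and the elementary symmetric function
  of the remaining entries are oppositely ordered in \<open>i\<close>.
\<close>

lemma Maclaurin_esym:
  assumes "finite A" "\<And>i. i \<in> A \<Longrightarrow> a i \<ge> 0" "s \<le> card A"
  shows "real (card A) ^ s * esym s A a \<le> real (card A choose s) * sum a A ^ s"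
  using assms(3)
proof (induction s)
  case 0
  then show ?case using assms(1) by (simp add: esym_0)
next
  case (Suc s)
  let ?N = "real (card A)"
  have "?N * (\<Sum>i\<in>A. a i * esym s (A - {i}) a) \<le> sum a A * (\<Sum>i\<in>A. esym s (A - {i}) a)"
    using esym_remove_antimono[OF assms(1,2)] by (intro Chebyshev_sum_opposite) auto
  then have step: "?N * (real (Suc s) * esym (Suc s) A a) \<le> sum a A * ((?N - real s) * esym s A a)"
    using sum_mult_esym_remove[OF assms(1) Suc.prems, of a] sum_esym_remove[OF assms(1), of s a] Suc.prems
    by simp
  have nn: "sum a A \<ge> 0" using assms(2) by (simp add: sum_nonneg)
  \<comment> \<open>The ratio of consecutive binomial coefficients matches the factors
    \<open>Suc s\<close> and \<open>?N - real s\<close> left by the two counting identities.\<close>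
  have ch: "real (Suc s) * real (card A choose Suc s) = (?N - real s) * real (card A choose s)"
    using binomial_absorb_comp[of "card A" s] Suc.prems
      binomial_absorption[of s "card A"] Suc_times_binomial_eq[of "card A" s]
    by (metis Suc_leD binomial_absorption of_nat_diff of_nat_mult)
  have "real (Suc s) * (?N ^ Suc s * esym (Suc s) A a) = ?N ^ s * (?N * (real (Suc s) * esym (Suc s) A a))"
    by simp
  also have "\<dots> \<le> ?N ^ s * (sum a A * ((?N - real s) * esym s A a))"
    by (intro mult_left_mono step) auto
  also have "\<dots> = sum a A * (?N - real s) * (?N ^ s * esym s A a)" by simp
  also have "\<dots> \<le> sum a A * (?N - real s) * (real (card A choose s) * sum a A ^ s)"
    using Suc nn by (intro mult_left_mono) auto
  also have "\<dots> = real (Suc s) * (real (card A choose Suc s) * sum a A ^ Suc s)"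
    by (simp only: ch mult.assoc[symmetric] power_Suc) (simp add: mult_ac)
  finally show ?case by (simp only: mult_le_cancel_left_pos of_nat_0_less_iff zero_less_Suc)
qed

text \<open>Both sides agree at 0, and their difference has derivative
  \<open>- 1 + y + exp (- y)\<close>, which is nonnegative. The linear term stays exact, so the mean
  survives in the Chernoff exponent.\<close>

lemma exp_minus_le_quadratic: "x \<ge> 0 \<Longrightarrow> exp (- x) \<le> 1 - x + x\<^sup>2 / (2::real)"
proof -
  assume "x \<ge> 0"
  define f where "f = (\<lambda>x::real. 1 - x + x\<^sup>2 / 2 - exp (- x))"
  have "f 0 \<le> f x"
  proof (rule DERIV_nonneg_imp_nondecreasing[OF \<open>x \<ge> 0\<close>])
    fix y :: real assume "0 \<le> y" "y \<le> x"
    have "(f has_real_derivative (- 1 + y + exp (- y))) (at y)"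
      unfolding f_def by (auto intro!: derivative_eq_intros)
    moreover have "- 1 + y + exp (- y) \<ge> 0" using exp_ge_add_one_self[of "-y"] by simp
    ultimately show "\<exists>z. (f has_real_derivative z) (at y) \<and> 0 \<le> z" by blast
  qed
  then show ?thesis by (simp add: f_def)
qed

text \<open>
  The moment generating function of a sample without replacement is a normalised elementary symmetric
  function, so Maclaurin's inequality bounds it by that of independent samples.
\<close>

lemma sampling_lower_tail:
  fixes z :: "'a \<Rightarrow> real"
  assumes fin: "finite A" and z: "\<And>i. i \<in> A \<Longrightarrow> 0 \<le> z i \<and> z i \<le> B"
    and s: "1 \<le> s" "s \<le> card A" and B: "B > 0" and t: "t \<ge> 0"
  shows "measure_pmf.prob (pmf_of_set {\<Omega>. \<Omega> \<subseteq> A \<and> card \<Omega> = s})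
      {\<Omega>. sum z \<Omega> / real s \<le> sum z A / real (card A) - t} \<le> exp (- real s * t\<^sup>2 / (2 * B\<^sup>2))"
proof -
  let ?S = "{\<Omega>. \<Omega> \<subseteq> A \<and> card \<Omega> = s}" and ?N = "real (card A)"
  let ?bad = "{\<Omega>. sum z \<Omega> / real s \<le> sum z A / ?N - t}"
  define \<mu> where "\<mu> = sum z A / ?N"
  \<comment> \<open>This \<open>l\<close> minimises the final exponent
    \<open>l\<^sup>2 * B\<^sup>2 / 2 - l * t\<close>.\<close>
  define l where "l = t / B\<^sup>2"
  define a where "a i = exp (- (l * z i))" for i
  have l: "l \<ge> 0" using t by (simp add: l_def)
  have N: "?N > 0" using s by simp
  have fS: "finite ?S" using fin by auto
  have cS: "card ?S = card A choose s" using fin by (rule n_subsets)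
  have chpos: "real (card A choose s) > 0" using s by simp
  then have neS: "?S \<noteq> {}" using cS by (metis card.empty of_nat_0 less_irrefl)
  have "sum a A \<le> (\<Sum>i\<in>A. 1 - l * z i + l\<^sup>2 * B\<^sup>2 / 2)"
  proof (rule sum_mono)
    fix i assume i: "i \<in> A"
    have "a i \<le> 1 - l * z i + (l * z i)\<^sup>2 / 2"
      unfolding a_def using l z[OF i] by (intro exp_minus_le_quadratic) auto
    also have "(l * z i)\<^sup>2 \<le> l\<^sup>2 * B\<^sup>2"
      unfolding power_mult_distrib using z[OF i] by (intro mult_left_mono power_mono) auto
    finally show "a i \<le> 1 - l * z i + l\<^sup>2 * B\<^sup>2 / 2" by simp
  qed
  also have "\<dots> = ?N * (1 + (- l * \<mu> + l\<^sup>2 * B\<^sup>2 / 2))"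
  proof -
    have "(\<Sum>i\<in>A. 1 - l * z i + l\<^sup>2 * B\<^sup>2 / 2) = ?N - l * sum z A + ?N * (l\<^sup>2 * B\<^sup>2 / 2)"
      by (simp add: sum.distrib sum_subtractf sum_distrib_left)
    moreover have "sum z A = ?N * \<mu>" using N by (simp add: \<mu>_def)
    ultimately show ?thesis by (simp add: algebra_simps)
  qed
  also have "\<dots> \<le> ?N * exp (- l * \<mu> + l\<^sup>2 * B\<^sup>2 / 2)"
    by (intro mult_left_mono exp_ge_add_one_self) auto
  finally have sa: "sum a A / ?N \<le> exp (- l * \<mu> + l\<^sup>2 * B\<^sup>2 / 2)"
    using N by (simp add: field_simps)
  have "esym s A a / real (card A choose s) \<le> (sum a A / ?N) ^ s"
    using Maclaurin_esym[of A a s] fin s N chpos by (simp add: a_def field_simps power_divide)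
  also have "\<dots> \<le> exp (- l * \<mu> + l\<^sup>2 * B\<^sup>2 / 2) ^ s"
    using sa N by (intro power_mono) (auto simp: a_def intro!: divide_nonneg_pos sum_nonneg)
  also have "\<dots> = exp (real s * (- l * \<mu> + l\<^sup>2 * B\<^sup>2 / 2))"
    by (simp add: exp_of_nat_mult)
  finally have mgf: "esym s A a / real (card A choose s) \<le> exp (real s * (- l * \<mu> + l\<^sup>2 * B\<^sup>2 / 2))" .
  have "real (card (?S \<inter> ?bad)) = (\<Sum>\<Omega>\<in>?S \<inter> ?bad. 1)" by simp
  \<comment> \<open>Exponential Markov inequality in counting form: every bad sample has weight at
    least 1, and the other samples only add nonnegative terms.\<close>
  also have "\<dots> \<le> (\<Sum>\<Omega>\<in>?S \<inter> ?bad. exp (l * real s * (\<mu> - t)) * (\<Prod>i\<in>\<Omega>. a i))"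
  proof (rule sum_mono)
    fix \<Omega> assume \<Omega>: "\<Omega> \<in> ?S \<inter> ?bad"
    then have f: "finite \<Omega>" using fin finite_subset by auto
    have "sum z \<Omega> \<le> real s * (\<mu> - t)" using \<Omega> s by (simp add: \<mu>_def field_simps)
    then have "l * sum z \<Omega> \<le> l * real s * (\<mu> - t)" using l by (simp add: mult_left_mono mult.assoc)
    then have "1 \<le> exp (l * real s * (\<mu> - t) + - (l * sum z \<Omega>))" by simp
    also have "\<dots> = exp (l * real s * (\<mu> - t)) * exp (- (l * sum z \<Omega>))" by (rule exp_add)
    also have "exp (- (l * sum z \<Omega>)) = (\<Prod>i\<in>\<Omega>. a i)"
      using exp_sum[OF f, of "\<lambda>i. - (l * z i)"]
      by (simp only: a_def sum_negf sum_distrib_left)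
    finally show "1 \<le> exp (l * real s * (\<mu> - t)) * (\<Prod>i\<in>\<Omega>. a i)" .
  qed
  also have "\<dots> \<le> (\<Sum>\<Omega>\<in>?S. exp (l * real s * (\<mu> - t)) * (\<Prod>i\<in>\<Omega>. a i))"
    by (intro sum_mono2 fS mult_nonneg_nonneg prod_nonneg) (auto simp: a_def)
  also have "\<dots> = exp (l * real s * (\<mu> - t)) * esym s A a"
    by (simp add: esym_def sum_distrib_left)
  finally have "real (card (?S \<inter> ?bad)) / real (card ?S)
      \<le> exp (l * real s * (\<mu> - t)) * (esym s A a / real (card A choose s))"
    unfolding cS times_divide_eq_right by (rule divide_right_mono) simp
  also have "\<dots> \<le> exp (l * real s * (\<mu> - t)) * exp (real s * (- l * \<mu> + l\<^sup>2 * B\<^sup>2 / 2))"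
    by (intro mult_left_mono mgf) auto
  also have "\<dots> = exp (- real s * t\<^sup>2 / (2 * B\<^sup>2))"
  proof -
    have "l * real s * (\<mu> - t) + real s * (- l * \<mu> + l\<^sup>2 * B\<^sup>2 / 2)
        = real s * (l\<^sup>2 * B\<^sup>2 / 2 - l * t)" by (simp add: algebra_simps)
    also have "\<dots> = - real s * t\<^sup>2 / (2 * B\<^sup>2)"
      using B by (simp add: l_def power_divide field_simps power2_eq_square)
    finally show ?thesis by (simp only: exp_add[symmetric])
  qed
  finally show ?thesis using measure_pmf_of_set[OF neS fS, of ?bad] by simp
qed

section \<open>Covering bounded low-rank matrices\<close>

text \<open>The shifted determinant vanishes only if \<open>- t\<close> is a root of the
  characteristic polynomial, and finitely many roots cannot exhaust \<open>{0<..<e}\<close>.\<close>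

lemma exists_small_shift_det_nonzero:
  fixes A :: "real mat"
  assumes A: "A \<in> carrier_mat r r" and e: "e > 0"
  shows "\<exists>t. 0 < t \<and> t < e \<and> det (A + t \<cdot>\<^sub>m 1\<^sub>m r) \<noteq> 0"
proof -
  have "char_poly A \<noteq> 0"
    using degree_monic_char_poly[OF A] by (metis coeff_0 zero_neq_one)
  then have "finite {x. poly (char_poly A) x = 0}" by (rule poly_roots_finite)
  then have "finite (uminus ` {x. poly (char_poly A) x = 0})" by simp
  moreover have "infinite {0<..<e}" using e by (simp add: infinite_Ioo)
  ultimately obtain t where t: "t \<in> {0<..<e}" "t \<notin> uminus ` {x. poly (char_poly A) x = 0}"
    by (meson finite_subset subsetI)
  have "poly (char_poly A) (- t) \<noteq> 0"
  proof
    assume "poly (char_poly A) (- t) = 0"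
    then have "- (- t) \<in> uminus ` {x. poly (char_poly A) x = 0}" by blast
    with t show False by simp
  qed
  then have "det (char_matrix A (- t)) \<noteq> 0"
    using eigenvalue_root_char_poly[OF A] eigenvalue_det[OF A] by blast
  moreover have "char_matrix A (- t) = A + t \<cdot>\<^sub>m 1\<^sub>m r"
    using A by (simp add: char_matrix_def)
  ultimately show ?thesis using t by auto
qed

text \<open>Choosing the \<open>r\<close> rows of maximal volume makes all coefficients bounded by 1, by Cramer's rule.\<close>

lemma max_volume_rows:
  fixes U :: "nat \<Rightarrow> nat \<Rightarrow> real"
  assumes f0: "f0 \<in> {..<r} \<rightarrow>\<^sub>E {..<m}"
    and det0: "det (mat r r (\<lambda>(a, b). U (f0 b) a)) \<noteq> 0"
  shows "\<exists>W f. (\<forall>l<r. f l < m) \<and> (\<forall>i<m. \<forall>l<r. \<bar>W i l\<bar> \<le> 1) \<and>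
    (\<forall>i<m. \<forall>b<r. U i b = (\<Sum>l<r. W i l * U (f l) b))"
proof -
  \<comment> \<open>The selected rows of \<open>U\<close> become the columns of \<open>D f\<close>,
    so expressing row \<open>i\<close> through them is a linear system with matrix
    \<open>D f\<close>.\<close>
  define D where "D f = mat r r (\<lambda>(a, b). U (f b) a)" for f
  let ?F = "{..<r} \<rightarrow>\<^sub>E {..<m}"
  have finF: "finite ?F" by (intro finite_PiE) auto
  have "\<exists>f\<in>?F. \<forall>g\<in>?F. \<bar>det (D g)\<bar> \<le> \<bar>det (D f)\<bar>"
  proof -
    have ne: "(\<lambda>f. \<bar>det (D f)\<bar>) ` ?F \<noteq> {}" using f0 by blast
    obtain f where "f \<in> ?F" "Max ((\<lambda>f. \<bar>det (D f)\<bar>) ` ?F) = \<bar>det (D f)\<bar>"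
      using Max_in[OF finite_imageI[OF finF] ne] by auto
    then show ?thesis using finF by (metis Max_ge finite_imageI imageI)
  qed
  then obtain f where f: "f \<in> ?F" and fmax: "\<And>g. g \<in> ?F \<Longrightarrow> \<bar>det (D g)\<bar> \<le> \<bar>det (D f)\<bar>"
    by blast
  have Dc: "D g \<in> carrier_mat r r" for g by (simp add: D_def)
  have d0: "\<bar>det (D f)\<bar> > 0" using fmax[OF f0] det0 by (simp add: D_def)
  define u where "u i = vec r (U i)" for i
  define w where "w i = (1 / det (D f)) \<cdot>\<^sub>v (adj_mat (D f) *\<^sub>v u i)" for i
  have w: "w i \<in> carrier_vec r" for i
    unfolding w_def u_def smult_carrier_vec
    by (rule mult_mat_vec_carrier[OF adj_mat(1)[OF Dc]]) simp
  have Dw: "D f *\<^sub>v w i = u i" for i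
  proof -
    have "D f *\<^sub>v w i = (1 / det (D f)) \<cdot>\<^sub>v ((D f * adj_mat (D f)) *\<^sub>v u i)"
      unfolding w_def using adj_mat(1)[OF Dc, of f] Dc[of f]
      by (subst mult_mat_vec[of _ r r]) (auto simp: u_def assoc_mult_mat_vec[of _ r r _ r])
    also have "\<dots> = (1 / det (D f)) \<cdot>\<^sub>v (det (D f) \<cdot>\<^sub>v u i)"
      unfolding adj_mat(2)[OF Dc] by (auto simp: u_def)
    finally show ?thesis using d0 by (simp add: smult_smult_assoc)
  qed
  have wle: "\<bar>w i $ l\<bar> \<le> 1" if "i < m" "l < r" for i l
  proof -
    let ?g = "f(l := i)"
    \<comment> \<open>Exchanging selected row \<open>l\<close> for row \<open>i\<close> is again an
      admissible selection, so maximality bounds the numerator in Cramer's rule.\<close>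
    have "replace_col (D f) (u i) l = D ?g"
      by (rule eq_matI) (auto simp: replace_col_def D_def u_def)
    then have "det (D ?g) = w i $ l * det (D f)"
      using cramer_lemma_mat[OF Dc w that(2), of f i] Dw by simp
    moreover have "?g \<in> ?F" using f that by (auto simp: PiE_iff extensional_def)
    ultimately have "\<bar>w i $ l\<bar> * \<bar>det (D f)\<bar> \<le> 1 * \<bar>det (D f)\<bar>"
      using fmax[of ?g] by (simp add: abs_mult)
    then show ?thesis using d0 mult_le_cancel_right_pos by blast
  qed
  have expand: "U i b = (\<Sum>l<r. w i $ l * U (f l) b)" if "b < r" for i b
  proof -
    have "U i b = (D f *\<^sub>v w i) $ b" using that by (simp add: Dw u_def)
    also have "\<dots> = (\<Sum>l<r. U (f l) b * w i $ l)"
      using that w[of i] by (simp add: D_def scalar_prod_def atLeast0LessThan)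
    finally show ?thesis by (simp add: mult.commute)
  qed
  have fm: "f l < m" if "l < r" for l using f that by auto
  show ?thesis
    using wle expand fm by (intro exI[of _ "\<lambda>i l. w i $ l"] exI[of _ f]) blast
qed

text \<open>Rank at most \<open>r\<close> is encoded by factors with inner dimension
  \<open>r\<close>. Functions on index pairs replace \<open>mat\<close>, so that errors become
  \<open>L2_set\<close> norms over sets of pairs; only values inside the index range are
  constrained.\<close>

definition lowrank_bounded :: "nat \<Rightarrow> nat \<Rightarrow> nat \<Rightarrow> real \<Rightarrow> (nat \<times> nat \<Rightarrow> real) set" where
  "lowrank_bounded m n r k = {X. (\<exists>U V. \<forall>i<m. \<forall>j<n. X (i, j) = (\<Sum>l<r. U i l * V j l)) \<and>
     (\<forall>i<m. \<forall>j<n. \<bar>X (i, j)\<bar> \<le> k)}"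

text \<open>
  \<open>U\<close> may be rank deficient; adding a small multiple of the identity to its top block makes it
  full rank, at the price of a perturbation of \<open>X\<close> by at most \<open>\<eta>\<close>.
\<close>

lemma lowrank_bounded_normal_form:
  assumes X: "X \<in> lowrank_bounded m n r k" and r: "r \<le> m" and \<eta>: "\<eta> > 0" "\<eta> \<le> k"
  shows "\<exists>W R. (\<forall>i<m. \<forall>l<r. \<bar>W i l\<bar> \<le> 1) \<and> (\<forall>l<r. \<forall>j<n. \<bar>R l j\<bar> \<le> (1::real)) \<and>
    (\<forall>i<m. \<forall>j<n. \<bar>X (i, j) - 2 * k * (\<Sum>l<r. W i l * R l j)\<bar> \<le> \<eta>)"
proof -
  obtain U V where UV: "\<And>i j. i < m \<Longrightarrow> j < n \<Longrightarrow> X (i, j) = (\<Sum>l<r. U i l * V j l)"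
    and Xk: "\<And>i j. i < m \<Longrightarrow> j < n \<Longrightarrow> \<bar>X (i, j)\<bar> \<le> k"
    using X unfolding lowrank_bounded_def by blast
  have k: "k > 0" using \<eta> by linarith
  \<comment> \<open>A common bound on the entries of \<open>V\<close>; the summand 1 keeps it
    positive, so that \<open>\<eta> / M\<close> is a valid bound for the shift.\<close>
  define M where "M = 1 + (\<Sum>j<n. \<Sum>l<r. \<bar>V j l\<bar>)"
  have M1: "M \<ge> 1" unfolding M_def by (simp add: sum_nonneg)
  have VM: "\<bar>V j l\<bar> \<le> M" if "j < n" "l < r" for j l
  proof -
    have "\<bar>V j l\<bar> \<le> (\<Sum>l<r. \<bar>V j l\<bar>)" using that by (intro member_le_sum) auto
    also have "\<dots> \<le> (\<Sum>j<n. \<Sum>l<r. \<bar>V j l\<bar>)"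
      using that by (intro member_le_sum[where f = "\<lambda>j. \<Sum>l<r. \<bar>V j l\<bar>"]) (auto intro: sum_nonneg)
    finally show ?thesis by (simp add: M_def)
  qed
  define A where "A = mat r r (\<lambda>(a, b). U b a)"
  have "A \<in> carrier_mat r r" by (simp add: A_def)
  then obtain t where t: "0 < t" "t < \<eta> / M" and det: "det (A + t \<cdot>\<^sub>m 1\<^sub>m r) \<noteq> 0"
    using exists_small_shift_det_nonzero[of A r "\<eta> / M"] \<eta> M1 by auto
  define U' where "U' i b = U i b + (if i = b then t else 0)" for i b
  \<comment> \<open>The top \<open>r\<close> rows: after the shift their matrix is invertible, so
    the maximal volume is nonzero.\<close>
  define f0 where "f0 = restrict id {..<r}"
  have "f0 \<in> {..<r} \<rightarrow>\<^sub>E {..<m}" using r by (auto simp: f0_def)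
  moreover have "mat r r (\<lambda>(a, b). U' (f0 b) a) = A + t \<cdot>\<^sub>m 1\<^sub>m r"
    by (rule eq_matI) (auto simp: U'_def A_def f0_def)
  ultimately obtain W f where f: "\<And>l. l < r \<Longrightarrow> f l < m"
    and W: "\<And>i l. i < m \<Longrightarrow> l < r \<Longrightarrow> \<bar>W i l\<bar> \<le> 1"
    and UW: "\<And>i b. i < m \<Longrightarrow> b < r \<Longrightarrow> U' i b = (\<Sum>l<r. W i l * U' (f l) b)"
    using max_volume_rows[of f0 r m U'] det by metis
  define X' where "X' i j = (\<Sum>b<r. U' i b * V j b)" for i j
  have close: "\<bar>X (i, j) - X' i j\<bar> \<le> \<eta>" if ij: "i < m" "j < n" for i j
  proof -
    have "X' i j - X (i, j) = (\<Sum>b<r. if i = b then t * V j b else 0)"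
      unfolding X'_def UV[OF ij] sum_subtractf[symmetric]
      by (intro sum.cong) (auto simp: U'_def algebra_simps)
    also have "\<dots> = (if i < r then t * V j i else 0)" by simp
    finally have "\<bar>X (i, j) - X' i j\<bar> \<le> t * M"
      using t VM[OF ij(2), of i] M1 by (auto simp: abs_mult abs_minus_commute)
    also have "t * M \<le> \<eta>" using t M1 by (simp add: field_simps)
    finally show ?thesis .
  qed
  have X'W: "X' i j = (\<Sum>l<r. W i l * X' (f l) j)" if "i < m" for i j
  proof -
    have "X' i j = (\<Sum>b<r. \<Sum>l<r. W i l * U' (f l) b * V j b)"
      unfolding X'_def using UW[OF that] by (simp add: sum_distrib_right)
    also have "\<dots> = (\<Sum>l<r. \<Sum>b<r. W i l * U' (f l) b * V j b)" by (rule sum.swap)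
    finally show ?thesis by (simp add: X'_def sum_distrib_left mult.assoc)
  qed
  \<comment> \<open>Entries of \<open>X'\<close> are at most \<open>k + \<eta> \<le> 2 * k\<close>,
    so this scaling puts both factors into [-1, 1] and one rounding grid serves both.\<close>
  define R where "R l j = X' (f l) j / (2 * k)" for l j
  have R: "\<bar>R l j\<bar> \<le> 1" if "l < r" "j < n" for l j
  proof -
    have "\<bar>X' (f l) j\<bar> \<le> 2 * k"
      using Xk[OF f[OF that(1)] that(2)] close[OF f[OF that(1)] that(2)] \<eta> by linarith
    then show ?thesis using k by (simp add: R_def)
  qed
  have "2 * k * (\<Sum>l<r. W i l * R l j) = X' i j" if "i < m" for i j
    using X'W[OF that, of j] k by (simp add: R_def sum_divide_distrib[symmetric])
  then show ?thesis using W R close by (intro exI[of _ W] exI[of _ R]) auto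
qed

text \<open>One representative per attained label. Taking it from \<open>S\<close> keeps the centres
  bounded, so that the tail bound applies to them.\<close>

lemma finite_cover_by_labels:
  assumes "finite F" "g ` S \<subseteq> F"
  shows "\<exists>T\<subseteq>S. finite T \<and> card T \<le> card F \<and> (\<forall>x\<in>S. \<exists>y\<in>T. g x = g y)"
proof -
  define h where "h = inv_into S g"
  have h: "h y \<in> S" "g (h y) = y" if "y \<in> g ` S" for y
    using that by (auto simp: h_def inv_into_into f_inv_into_f)
  have fin: "finite (g ` S)" using assms finite_subset by blast
  have "card (h ` g ` S) \<le> card (g ` S)" using fin by (rule card_image_le)
  also have "\<dots> \<le> card F" using assms by (intro card_mono)
  finally have "card (h ` g ` S) \<le> card F" .
  then show ?thesis using fin h by (intro exI[of _ "h ` g ` S"]) auto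
qed

text \<open>Each of the at most \<open>2 * n * r\<close> entries of the two factors is rounded to
  one of at most \<open>n ^ 4\<close> values, which gives the exponent \<open>8 * n * r\<close>.
  Matrices with equal rounded factors are close.\<close>

lemma lowrank_bounded_cover:
  assumes r: "1 \<le> r" "r \<le> m" "m \<le> n" and n: "2 \<le> n" and k: "k > 0"
  shows "\<exists>T\<subseteq>lowrank_bounded m n r k. finite T \<and> card T \<le> n ^ (8 * n * r) \<and>
    (\<forall>X\<in>lowrank_bounded m n r k. \<exists>X'\<in>T. \<forall>i<m. \<forall>j<n. \<bar>X (i, j) - X' (i, j)\<bar> \<le> 6 * k / real n)"
proof -
  let ?S = "lowrank_bounded m n r k"
  define \<eta> where "\<eta> = k / real n"
  have \<eta>: "\<eta> > 0" "\<eta> \<le> k" using n k by (auto simp: \<eta>_def field_simps)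
  define P where "P X W R \<longleftrightarrow> (\<forall>i<m. \<forall>l<r. \<bar>W i l\<bar> \<le> 1) \<and> (\<forall>l<r. \<forall>j<n. \<bar>R l j\<bar> \<le> (1::real)) \<and>
    (\<forall>i<m. \<forall>j<n. \<bar>X (i, j) - 2 * k * (\<Sum>l<r. W i l * R l j)\<bar> \<le> \<eta>)" for X W R
  have "\<exists>W R. P X W R" if "X \<in> ?S" for X
    unfolding P_def by (rule lowrank_bounded_normal_form[OF that r(2) \<eta>])
  then have "\<forall>X\<in>?S. \<exists>p. P X (fst p) (snd p)" by (metis fst_conv snd_conv)
  then obtain p where p: "\<forall>X\<in>?S. P X (fst (p X)) (snd (p X))" by (rule bchoice[THEN exE])
  define W where "W X = fst (p X)" for X
  define R where "R X = snd (p X)" for X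
  have WR: "P X (W X) (R X)" if "X \<in> ?S" for X using p that by (simp add: W_def R_def)
  have W: "\<bar>W X i l\<bar> \<le> 1" if "X \<in> ?S" "i < m" "l < r" for X i l
    using WR[OF that(1)] that unfolding P_def by blast
  have R: "\<bar>R X l j\<bar> \<le> 1" if "X \<in> ?S" "l < r" "j < n" for X l j
    using WR[OF that(1)] that unfolding P_def by blast
  have close: "\<bar>X (i, j) - 2 * k * (\<Sum>l<r. W X i l * R X l j)\<bar> \<le> \<eta>"
    if "X \<in> ?S" "i < m" "j < n" for X i j
    using WR[OF that(1)] that unfolding P_def by blast
  \<comment> \<open>Mesh 1/n^2: each product in the inner sum then moves by at most 2/n^2, and the
    sum of \<open>r \<le> n\<close> of them by at most 2/n.\<close>
  define q where "q x = \<lfloor>x * real n ^ 2\<rfloor>" for x :: real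
  define g where "g X = (restrict (\<lambda>(i, l). q (W X i l)) ({..<m} \<times> {..<r}),
      restrict (\<lambda>(l, j). q (R X l j)) ({..<r} \<times> {..<n}))" for X
  define Q where "Q = {- (int n)\<^sup>2..(int n)\<^sup>2}"
  define F where "F = (({..<m} \<times> {..<r}) \<rightarrow>\<^sub>E Q) \<times> (({..<r} \<times> {..<n}) \<rightarrow>\<^sub>E Q)"
  have qQ: "q x \<in> Q" if "\<bar>x\<bar> \<le> 1" for x
  proof -
    have "\<bar>x * (real n)\<^sup>2\<bar> \<le> 1 * (real n)\<^sup>2"
      unfolding abs_mult using that by (intro mult_mono) auto
    then have "- ((real n)\<^sup>2) \<le> x * (real n)\<^sup>2" "x * (real n)\<^sup>2 \<le> (real n)\<^sup>2" by linarith+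
    then have "of_int (- (int n)\<^sup>2) \<le> x * (real n)\<^sup>2" "x * (real n)\<^sup>2 < of_int ((int n)\<^sup>2) + 1" by auto
    then show ?thesis unfolding q_def Q_def
      by (simp only: atLeastAtMost_iff le_floor_iff floor_le_iff)
  qed
  have qclose: "\<bar>x - y\<bar> \<le> 1 / real n ^ 2" if "q x = q y" for x y
  proof -
    have "\<bar>x * real n ^ 2 - y * real n ^ 2\<bar> \<le> 1"
      using that unfolding q_def by linarith
    then have "\<bar>x - y\<bar> * real n ^ 2 \<le> 1" by (simp add: abs_mult left_diff_distrib[symmetric])
    then show ?thesis using n by (simp add: field_simps)
  qed
  have finQ: "finite Q" by (simp add: Q_def)
  have finF: "finite F" unfolding F_def using finQ by (intro finite_cartesian_product finite_PiE) auto
  have gF: "g ` ?S \<subseteq> F"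
  proof
    fix y assume "y \<in> g ` ?S"
    then obtain X where X: "X \<in> ?S" "y = g X" by blast
    show "y \<in> F" unfolding X(2) g_def F_def
      by (auto intro!: qQ W[OF X(1)] R[OF X(1)])
  qed
  obtain T where T: "T \<subseteq> ?S" "finite T" "card T \<le> card F" "\<And>X. X \<in> ?S \<Longrightarrow> \<exists>Y\<in>T. g X = g Y"
    using finite_cover_by_labels[OF finF gF] by blast
  \<comment> \<open>The grid has 2 n^2 + 1 points; comparing this with n^4 is where
    \<open>2 \<le> n\<close> enters.\<close>
  have n4: "card Q \<le> n ^ 4"
  proof -
    have "2 * int n * int n \<ge> 2 * 2 * 2" using n by (intro mult_mono) auto
    then have nn: "int n ^ 2 \<ge> 4" by (simp add: power2_eq_square)
    then have "4 * int n ^ 2 \<le> int n ^ 2 * int n ^ 2" by (intro mult_right_mono) auto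
    moreover have "int (n ^ 4) = int n ^ 2 * int n ^ 2" by (simp add: power_add[symmetric])
    ultimately have "2 * int n ^ 2 + 1 \<le> int (n ^ 4)" using nn by linarith
    then show ?thesis unfolding Q_def by (simp add: nat_le_iff)
  qed
  have "card F = card Q ^ (m * r) * card Q ^ (r * n)"
    by (simp add: F_def card_cartesian_product card_PiE)
  also have "\<dots> = card Q ^ (m * r + r * n)" by (simp add: power_add)
  also have "\<dots> \<le> (n ^ 4) ^ (m * r + r * n)" by (intro power_mono n4) auto
  also have "\<dots> = n ^ (4 * (m * r + r * n))" by (rule power_mult[symmetric])
  also have "\<dots> \<le> n ^ (8 * n * r)"
  proof (rule power_increasing)
    have "m * r \<le> n * r" using r by simp
    then show "4 * (m * r + r * n) \<le> 8 * n * r" by (simp add: algebra_simps)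
  qed (use n in auto)
  finally have cF: "card F \<le> n ^ (8 * n * r)" .
  have "\<bar>X (i, j) - Y (i, j)\<bar> \<le> 6 * k / real n"
    if XY: "X \<in> ?S" "Y \<in> ?S" "g X = g Y" and ij: "i < m" "j < n" for X Y i j
  proof -
    have qW: "q (W X i l) = q (W Y i l)" if "l < r" for l
      using arg_cong[OF XY(3), of "\<lambda>y. fst y (i, l)"] that ij by (simp add: g_def)
    have qR: "q (R X l j) = q (R Y l j)" if "l < r" for l
      using arg_cong[OF XY(3), of "\<lambda>y. snd y (l, j)"] that ij by (simp add: g_def)
    have tm: "\<bar>W X i l * R X l j - W Y i l * R Y l j\<bar> \<le> 2 / real n ^ 2" if l: "l < r" for l
    proof -
      have "W X i l * R X l j - W Y i l * R Y l j
          = (W X i l - W Y i l) * R X l j + W Y i l * (R X l j - R Y l j)" by (simp add: algebra_simps)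
      also have "\<bar>\<dots>\<bar> \<le> \<bar>W X i l - W Y i l\<bar> * \<bar>R X l j\<bar> + \<bar>W Y i l\<bar> * \<bar>R X l j - R Y l j\<bar>"
        unfolding abs_mult[symmetric] by (rule abs_triangle_ineq)
      also have "\<dots> \<le> 1 / real n ^ 2 * 1 + 1 * (1 / real n ^ 2)"
        using qclose[OF qW[OF l]] qclose[OF qR[OF l]] W[OF XY(2) ij(1) l] R[OF XY(1) l ij(2)]
        by (intro add_mono mult_mono) auto
      finally show ?thesis by simp
    qed
    have "\<bar>(\<Sum>l<r. W X i l * R X l j) - (\<Sum>l<r. W Y i l * R Y l j)\<bar> \<le> (\<Sum>l<r. 2 / real n ^ 2)"
      unfolding sum_subtractf[symmetric] using tm by (intro order.trans[OF sum_abs] sum_mono) auto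
    also have "\<dots> = real r * (2 / real n ^ 2)" by simp
    also have "\<dots> \<le> real n * (2 / real n ^ 2)" using r by (intro mult_right_mono) auto
    also have "\<dots> = 2 / real n" using n by (simp add: power2_eq_square)
    finally have "2 * k * \<bar>(\<Sum>l<r. W X i l * R X l j) - (\<Sum>l<r. W Y i l * R Y l j)\<bar> \<le> 2 * k * (2 / real n)"
      using k by (intro mult_left_mono) auto
    then have "\<bar>2 * k * (\<Sum>l<r. W X i l * R X l j) - 2 * k * (\<Sum>l<r. W Y i l * R Y l j)\<bar> \<le> 4 * k / real n"
      using k by (simp add: abs_mult right_diff_distrib[symmetric])
    \<comment> \<open>Rounding costs 4k/n, and the normal forms of \<open>X\<close> and
      \<open>Y\<close> cost one \<open>\<eta>\<close> each.\<close>
    moreover have "4 * k / real n + 2 * \<eta> = 6 * k / real n" by (simp add: \<eta>_def)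
    ultimately show ?thesis using close[OF XY(1) ij] close[OF XY(2) ij] by linarith
  qed
  then show ?thesis using T cF by (intro exI[of _ T]) (meson order_trans subsetD)
qed

section \<open>Rank factorization\<close>

text \<open>A maximal independent set of columns has \<open>r\<close> elements and spans all
  columns; the coordinates of the columns fill \<open>V\<close>. This makes the true matrix feasible
  for the optimisation problem.\<close>

lemma rank_factorization:
  fixes Y :: "real mat"
  assumes Y: "Y \<in> carrier_mat m n" and rk: "vec_space.rank m Y = r"
  shows "\<exists>U V. U \<in> carrier_mat m r \<and> V \<in> carrier_mat n r \<and> Y = U * transpose_mat V"
proof -
  interpret vec_space "TYPE(real)" m .
  have cY: "set (cols Y) \<subseteq> carrier_vec m" using Y cols_dim by blast
  obtain S where S: "maximal S (\<lambda>T. T \<subseteq> set (cols Y) \<and> lin_indpt T)" and finS: "finite S"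
    using maximal_exists_superset[of "set (cols Y)" "\<lambda>T. T \<subseteq> set (cols Y) \<and> lin_indpt T" "{}"]
    by (auto simp: lin_dep_def)
  have cS: "card S = r" using rank_card_indpt[OF Y S] rk by simp
  have S1: "S \<subseteq> set (cols Y)" "lin_indpt S" using S unfolding maximal_def by auto
  have Scar: "S \<subseteq> carrier_vec m" using S1 cY by blast
  have sp: "v \<in> span S" if v: "v \<in> set (cols Y)" for v
  proof (rule ccontr)
    assume nv: "v \<notin> span S"
    have "v \<notin> S" using nv span_mem[OF Scar] by blast
    have "lin_indpt (S \<union> {v})"
      using lin_dep_iff_in_span[OF Scar S1(2) _ \<open>v \<notin> S\<close>] nv v cY by blast
    then have "S \<union> {v} = S" using S S1 v unfolding maximal_def by blast
    then show False using \<open>v \<notin> S\<close> by blast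
  qed
  obtain ws where ws: "set ws = S" "distinct ws" using finite_distinct_list[OF finS] by blast
  have len: "length ws = r" using ws cS distinct_card by fastforce
  have "\<exists>c. col Y j = mat_of_cols m ws *\<^sub>v vec r c" if "j < n" for j
  proof -
    have "col Y j \<in> set (cols Y)" using that Y by (metis carrier_matD(2) cols_length cols_nth nth_mem)
    then have "col Y j \<in> span_list ws"
      using sp span_list_as_span[of ws] Scar ws by auto
    then obtain c where "col Y j = lincomb_list c ws" unfolding span_list_def by blast
    moreover have "\<forall>w\<in>set ws. dim_vec w = m" using Scar ws by auto
    ultimately show ?thesis using lincomb_list_as_mat_mult[of ws c] len by auto
  qed
  then obtain c where c: "\<And>j. j < n \<Longrightarrow> col Y j = mat_of_cols m ws *\<^sub>v vec r (c j)" by metis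
  define V where "V = mat n r (\<lambda>(j, l). c j l)"
  have "Y = mat_of_cols m ws * transpose_mat V"
  proof (rule mat_col_eqI)
    fix j assume "j < dim_col (mat_of_cols m ws * transpose_mat V)"
    then have j: "j < n" by (simp add: V_def)
    have "col (transpose_mat V) j = vec r (c j)" using j by (auto simp: V_def)
    then show "col Y j = col (mat_of_cols m ws * transpose_mat V) j"
      using c[OF j] j len by (subst col_mult2[of _ m r _ n]) (auto simp: V_def)
  qed (use Y in \<open>auto simp: V_def\<close>)
  then show ?thesis using len by (intro exI[of _ "mat_of_cols m ws"] exI[of _ V]) (auto simp: V_def)
qed

section \<open>Uniform deviation and recovery error\<close>

lemma frob_norm_L2_set: "frob_norm A = L2_set (\<lambda>p. A $$ p) ({..<dim_row A} \<times> {..<dim_col A})"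
  by (simp add: frob_norm_def L2_set_def sum.cartesian_product)

lemma frob_norm_samp:
  assumes "\<Omega> \<subseteq> {..<dim_row A} \<times> {..<dim_col A}"
  shows "frob_norm (samp \<Omega> A) = L2_set (\<lambda>p. A $$ p) \<Omega>"
proof -
  have "(\<Sum>p\<in>{..<dim_row A} \<times> {..<dim_col A}. (samp \<Omega> A $$ p)\<^sup>2)
      = (\<Sum>p\<in>{..<dim_row A} \<times> {..<dim_col A}. if p \<in> \<Omega> then (A $$ p)\<^sup>2 else 0)"
    by (intro sum.cong) (auto simp: samp_def)
  also have "\<dots> = (\<Sum>p\<in>\<Omega>. (A $$ p)\<^sup>2)"
    using assms by (subst sum.inter_restrict[symmetric]) (auto simp: Int_absorb1)
  finally show ?thesis by (simp add: frob_norm_L2_set L2_set_def samp_def)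
qed

lemma L2_set_abs: "L2_set (\<lambda>i. \<bar>f i\<bar>) A = L2_set f A"
  by (simp add: L2_set_def)

lemma L2_set_diff_triangle: "L2_set f A \<le> L2_set g A + L2_set (\<lambda>i. f i - g i) A"
  using L2_set_triangle_ineq[of g "\<lambda>i. f i - g i" A] by simp

text \<open>Minkowski's inequality with the constant \<open>\<epsilon>\<close>. It moves root mean
  squares between a matrix and its cover centre, on the full index set as well as on the
  sample.\<close>

lemma normalized_L2_set_close:
  assumes "\<And>i. i \<in> A \<Longrightarrow> \<bar>f i - g i\<bar> \<le> \<epsilon>" and "card A > 0"
  shows "L2_set f A / sqrt (card A) \<le> L2_set g A / sqrt (card A) + \<epsilon>"
proof -
  have "A \<noteq> {}" using assms(2) by auto
  then have \<epsilon>: "\<epsilon> \<ge> 0" using assms(1) by (meson abs_ge_zero ex_in_conv order_trans)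
  have "L2_set (\<lambda>i. f i - g i) A \<le> L2_set (\<lambda>i. \<epsilon>) A"
    unfolding L2_set_abs[of "\<lambda>i. f i - g i", symmetric] using assms(1) by (intro L2_set_mono) auto
  also have "\<dots> = sqrt (card A) * \<epsilon>" using \<epsilon> by (simp add: L2_set_constant)
  finally have "L2_set f A \<le> L2_set g A + sqrt (card A) * \<epsilon>"
    using L2_set_diff_triangle[of f A g] by linarith
  then show ?thesis using assms(2) by (simp add: field_simps)
qed

lemma powr_quarter: "x \<ge> 0 \<Longrightarrow> x powr (1 / 4) = sqrt (sqrt x)"
  by (simp add: powr_half_sqrt[symmetric] powr_powr)

text \<open>The bound on \<open>s\<close> makes the family of samples nonempty, as
  \<open>pmf_of_set\<close> requires.\<close>

lemma set_pmf_uniform_samples: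
  assumes "s \<le> m * n"
  shows "set_pmf (uniform_samples m n s) = {\<Omega>. \<Omega> \<subseteq> {..<m} \<times> {..<n} \<and> card \<Omega> = s}"
proof -
  have "card {\<Omega>. \<Omega> \<subseteq> {..<m} \<times> {..<n} \<and> card \<Omega> = s} = (m * n) choose s"
    using n_subsets[of "{..<m} \<times> {..<n}" s] by simp
  also have "\<dots> \<noteq> 0" using assms by simp
  finally have "{\<Omega>. \<Omega> \<subseteq> {..<m} \<times> {..<n} \<and> card \<Omega> = s} \<noteq> {}" by (metis card.empty)
  then show ?thesis unfolding uniform_samples_def by (rule set_pmf_of_set) simp
qed

text \<open>Union bound over the cover centres. The constant is 17 = 5 + 6 + 6: 5 from the deviation
  at a centre, and 6 each for passing to the centre on the full index set and back on the
  sample.\<close>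

lemma lowrank_uniform_deviation:
  fixes Z :: "nat \<times> nat \<Rightarrow> real"
  assumes r: "1 \<le> r" "r \<le> m" "m \<le> n" and n: "2 \<le> n" and s: "1 \<le> s" "s \<le> m * n" and k: "k > 0"
    and Z: "\<And>i j. i < m \<Longrightarrow> j < n \<Longrightarrow> \<bar>Z (i, j)\<bar> \<le> k"
  shows "measure_pmf.prob (uniform_samples m n s)
    {\<Omega>. \<forall>X\<in>lowrank_bounded m n r k.
       L2_set (\<lambda>p. X p - Z p) ({..<m} \<times> {..<n}) / sqrt (real (m * n))
       \<le> L2_set (\<lambda>p. X p - Z p) \<Omega> / sqrt (real s)
         + 17 * k * (real (n * r) * ln (real n) / real s) powr (1 / 4)} \<ge> 1 - exp (- real n)"
    (is "measure_pmf.prob ?p ?good \<ge> _")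
proof -
  let ?I = "{..<m} \<times> {..<n}" and ?S = "lowrank_bounded m n r k"
  define a where "a = real (n * r) * ln (real n)"
  define q where "q = a / real s"
  \<comment> \<open>Chosen so that \<open>sqrt t\<close> is \<open>5 * k * q powr (1 / 4)\<close>
    while the tail exponent becomes 625/32 a, enough to beat the 8 a of the cover.\<close>
  define t where "t = 25 * k\<^sup>2 * sqrt q"
  define bad where "bad X = {\<Omega>. (\<Sum>p\<in>\<Omega>. (X p - Z p)\<^sup>2) / real s
      \<le> (\<Sum>p\<in>?I. (X p - Z p)\<^sup>2) / real (card ?I) - t}" for X
  have ln: "ln (real n) \<ge> 1 / 2"
  proof -
    have "ln 2 \<le> ln (real n)" using n by simp
    then show ?thesis using ln2_ge_two_thirds by linarith
  qed
  have a: "a \<ge> real n / 2"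
  proof -
    have "real n * 1 \<le> real n * real r" using r by (intro mult_left_mono) auto
    then have "(real n * 1) * (1 / 2) \<le> (real n * real r) * ln (real n)" by (rule mult_mono) (use ln r in auto)
    then show ?thesis by (simp add: a_def)
  qed
  have a0: "a \<ge> 0" using a by linarith
  have q0: "q \<ge> 0" using a0 by (simp add: q_def)
  have t0: "t \<ge> 0" using q0 by (simp add: t_def)
  have sq: "sqrt t = 5 * k * q powr (1 / 4)"
  proof -
    have "sqrt (25 * k\<^sup>2) = sqrt ((5 * k)\<^sup>2)" by (simp add: power_mult_distrib)
    also have "\<dots> = 5 * k" using k by (subst real_sqrt_abs) simp
    finally show ?thesis unfolding t_def real_sqrt_mult[of "25 * k\<^sup>2"] using powr_quarter[OF q0] by simp
  qed
  \<comment> \<open>Absorbs the cover radius into the target bound: \<open>s \<le> n * n\<close> and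
    \<open>a \<ge> real n / 2\<close> give q >= 1/(2n) >= 1/n^4.\<close>
  have n_le: "1 / real n \<le> q powr (1 / 4)"
  proof -
    have "m * n \<le> n * n" using r by simp
    then have sn: "s \<le> n * n" using s by linarith
    have "2 * 2 * 2 \<le> real n * real n * real n" using n by (intro mult_mono) auto
    then have n3: "2 \<le> real n ^ 3" by (simp add: power3_eq_cube)
    have "(1 / real n) ^ 4 \<le> 1 / (2 * real n)"
    proof -
      have "2 * real n \<le> real n ^ 3 * real n" using n3 by (intro mult_right_mono) auto
      also have "\<dots> = real n ^ 4" by (simp add: power3_eq_cube power4_eq_xxxx)
      finally show ?thesis using n by (simp add: power_one_over frac_le)
    qed
    also have "\<dots> = (real n / 2) / (real n * real n)" using n by simp
    also have "\<dots> \<le> a / real s"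
    proof (rule frac_le)
      show "real s \<le> real n * real n" using sn by (metis of_nat_le_iff of_nat_mult)
    qed (use a a0 s in auto)
    finally have "(1 / real n) ^ 4 \<le> q" by (simp add: q_def)
    then have "((1 / real n) ^ 4) powr (1 / 4) \<le> q powr (1 / 4)" by (intro powr_mono2) auto
    moreover have "((1 / real n) ^ 4) powr (1 / 4) = 1 / real n"
    proof -
      have "((1 / real n) ^ 4) powr (1 / 4) = ((1 / real n) powr 4) powr (1 / 4)"
        using n by (subst powr_numeral) auto
      also have "\<dots> = 1 / real n" using n unfolding powr_powr by simp
      finally show ?thesis .
    qed
    ultimately show ?thesis by simp
  qed
  obtain T where T: "T \<subseteq> ?S" "finite T" "card T \<le> n ^ (8 * n * r)"
    and cover: "\<And>X. X \<in> ?S \<Longrightarrow> \<exists>X'\<in>T. \<forall>i<m. \<forall>j<n. \<bar>X (i, j) - X' (i, j)\<bar> \<le> 6 * k / real n"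
    using lowrank_bounded_cover[OF r n k] by blast
  have cI: "card ?I = m * n" by simp
  have badX: "measure_pmf.prob ?p (bad X) \<le> exp (- (19 * a))" if X: "X \<in> ?S" for X
  proof -
    \<comment> \<open>Two values in [-k, k] differ by at most 2k, so the tail bound is applied with
      \<open>B = 4 * k\<^sup>2\<close>.\<close>
    have "0 \<le> (X p - Z p)\<^sup>2 \<and> (X p - Z p)\<^sup>2 \<le> 4 * k\<^sup>2" if p: "p \<in> ?I" for p
    proof -
      obtain i j where ij: "p = (i, j)" "i < m" "j < n" using p by auto
      then have "\<bar>X p\<bar> \<le> k" using X by (auto simp: lowrank_bounded_def)
      then have "\<bar>X p - Z p\<bar> \<le> 2 * k" using Z[OF ij(2,3)] unfolding ij(1) by linarith
      then have "\<bar>X p - Z p\<bar>\<^sup>2 \<le> (2 * k)\<^sup>2" by (intro power_mono) auto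
      then show ?thesis by (simp add: power_mult_distrib)
    qed
    then have "measure_pmf.prob ?p (bad X) \<le> exp (- real s * t\<^sup>2 / (2 * (4 * k\<^sup>2)\<^sup>2))"
      unfolding uniform_samples_def bad_def using k s t0 by (intro sampling_lower_tail) auto
    also have "- real s * t\<^sup>2 / (2 * (4 * k\<^sup>2)\<^sup>2) = - (625 / 32 * a)"
    proof -
      have "t\<^sup>2 = 625 * (k\<^sup>2)\<^sup>2 * q" using q0 by (simp add: t_def power_mult_distrib)
      then have "- real s * t\<^sup>2 / (2 * (4 * k\<^sup>2)\<^sup>2) = - (625 / 32 * (real s * q))"
        using k by (simp add: power_mult_distrib)
      then show ?thesis using s by (simp add: q_def)
    qed
    also have "exp (- (625 / 32 * a)) \<le> exp (- (19 * a))" using a0 by simp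
    finally show ?thesis .
  qed
  have "measure_pmf.prob ?p (\<Union>X\<in>T. bad X) \<le> (\<Sum>X\<in>T. measure_pmf.prob ?p (bad X))"
    using T(2) by (intro measure_pmf.finite_measure_subadditive_finite) auto
  also have "\<dots> \<le> (\<Sum>X\<in>T. exp (- (19 * a)))" using T(1) badX by (intro sum_mono) auto
  also have "\<dots> = real (card T) * exp (- (19 * a))" by simp
  \<comment> \<open>The cover size is at most \<open>n ^ (8 * n * r)\<close>, which is exactly
    \<open>exp (8 * a)\<close>; the remaining 11 a exceeds n because
    \<open>a \<ge> real n / 2\<close>.\<close>
  also have "\<dots> \<le> exp (8 * a) * exp (- (19 * a))"
  proof (rule mult_right_mono)
    have "real (card T) \<le> real n ^ (8 * n * r)"
      using T(3) by (metis of_nat_le_iff of_nat_power)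
    also have "\<dots> = exp (ln (real n)) ^ (8 * n * r)" using n by simp
    also have "\<dots> = exp (8 * a)" by (simp add: a_def exp_of_nat_mult[symmetric] mult_ac)
    finally show "real (card T) \<le> exp (8 * a)" .
  qed simp
  also have "\<dots> = exp (- (11 * a))" by (simp add: exp_add[symmetric])
  also have "\<dots> \<le> exp (- real n)" using a a0 by simp
  finally have pbad: "measure_pmf.prob ?p (\<Union>X\<in>T. bad X) \<le> exp (- real n)" .
  have good: "\<Omega> \<in> ?good" if \<Omega>: "\<Omega> \<in> set_pmf ?p" "\<Omega> \<notin> (\<Union>X\<in>T. bad X)" for \<Omega>
  proof (intro CollectI ballI)
    fix X assume X: "X \<in> ?S"
    then obtain X' where X': "X' \<in> T" and cl: "\<And>i j. i < m \<Longrightarrow> j < n \<Longrightarrow> \<bar>X (i, j) - X' (i, j)\<bar> \<le> 6 * k / real n"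
      using cover by blast
    have \<Omega>I: "\<Omega> \<subseteq> ?I" "card \<Omega> = s" using \<Omega>(1) set_pmf_uniform_samples[OF s(2)] by auto
    let ?A = "\<lambda>W B. (\<Sum>p\<in>B. (W p - Z p)\<^sup>2)"
    have "L2_set (\<lambda>p. X p - Z p) ?I / sqrt (card ?I) \<le> L2_set (\<lambda>p. X' p - Z p) ?I / sqrt (card ?I) + 6 * k / real n"
      using cl r n by (intro normalized_L2_set_close) auto
    moreover have "L2_set (\<lambda>p. X' p - Z p) \<Omega> / sqrt (card \<Omega>) \<le> L2_set (\<lambda>p. X p - Z p) \<Omega> / sqrt (card \<Omega>) + 6 * k / real n"
      using cl \<Omega>I s by (intro normalized_L2_set_close) (auto simp: abs_minus_commute)
    moreover have "L2_set (\<lambda>p. X' p - Z p) ?I / sqrt (real (m * n))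
        \<le> L2_set (\<lambda>p. X' p - Z p) \<Omega> / sqrt (real s) + sqrt t"
    proof -
      have "\<Omega> \<notin> bad X'" using \<Omega>(2) X' by blast
      then have le: "?A X' ?I / real (m * n) \<le> ?A X' \<Omega> / real s + t"
        unfolding bad_def mem_Collect_eq cI by linarith
      have "sqrt (?A X' ?I / real (m * n)) \<le> sqrt (?A X' \<Omega> / real s + t)" by (rule real_sqrt_le_mono[OF le])
      \<comment> \<open>Subadditivity of the square root turns the gap \<open>t\<close> in mean
        squares, of order sqrt q, into a gap of order q^(1/4) in root mean squares.\<close>
      also have "\<dots> \<le> sqrt (?A X' \<Omega> / real s) + sqrt t"
        using t0 by (intro sqrt_add_le_add_sqrt) (auto intro!: divide_nonneg_nonneg sum_nonneg)
      finally show ?thesis by (simp only: L2_set_def real_sqrt_divide)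
    qed
    moreover have "6 * k / real n \<le> 6 * k * q powr (1 / 4)"
      using mult_left_mono[OF n_le, of "6 * k"] k by simp
    ultimately show "L2_set (\<lambda>p. X p - Z p) ?I / sqrt (real (m * n))
       \<le> L2_set (\<lambda>p. X p - Z p) \<Omega> / sqrt (real s) + 17 * k * (real (n * r) * ln (real n) / real s) powr (1 / 4)"
      unfolding cI \<Omega>I(2) sq a_def[symmetric] q_def[symmetric] mult.assoc by linarith
  qed
  \<comment> \<open>The inclusion in the good event is known only for samples in the support, hence
    the intersection with \<open>set_pmf ?p\<close>.\<close>
  have "1 - measure_pmf.prob ?p (\<Union>X\<in>T. bad X) = measure_pmf.prob ?p (- (\<Union>X\<in>T. bad X))"
    using measure_pmf.prob_compl[of "\<Union>X\<in>T. bad X" ?p] by (simp add: Compl_eq_Diff_UNIV)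
  also have "\<dots> = measure_pmf.prob ?p (- (\<Union>X\<in>T. bad X) \<inter> set_pmf ?p)"
    by (simp add: measure_Int_set_pmf)
  also have "\<dots> \<le> measure_pmf.prob ?p ?good"
    using good by (intro measure_pmf.finite_measure_mono) auto
  finally show ?thesis using pbad by linarith
qed

section \<open>From optimality to the recovery error\<close>

lemma mat_mult_transpose_index:
  assumes "U \<in> carrier_mat m r" "V \<in> carrier_mat n r" "i < m" "j < n"
  shows "(U * transpose_mat V) $$ (i, j) = (\<Sum>l<r. U $$ (i, l) * V $$ (j, l))"
  using assms by (auto simp: scalar_prod_def atLeast0LessThan)

lemma mf_feasible_lowrank_bounded:
  assumes "mf_feasible m n r k (U, V)"
  shows "(\<lambda>p. (U * transpose_mat V) $$ p) \<in> lowrank_bounded m n r k"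
proof -
  have UV: "U \<in> carrier_mat m r" "V \<in> carrier_mat n r" "entries_bounded k (U * transpose_mat V)"
    using assms by (auto simp: mf_feasible_def)
  have "\<bar>(U * transpose_mat V) $$ (i, j)\<bar> \<le> k" if "i < m" "j < n" for i j
  proof -
    have "dim_row (U * transpose_mat V) = m" "dim_col (U * transpose_mat V) = n" using UV by auto
    then show ?thesis using UV(3) that unfolding entries_bounded_def by blast
  qed
  moreover have "\<exists>A B. \<forall>i<m. \<forall>j<n. (U * transpose_mat V) $$ (i, j) = (\<Sum>l<r. A i l * B j l)"
    by (intro exI[of _ "\<lambda>i l. U $$ (i, l)"] exI[of _ "\<lambda>j l. V $$ (j, l)"] allI impI
        mat_mult_transpose_index[OF UV(1,2)])
  ultimately show ?thesis unfolding lowrank_bounded_def mem_Collect_eq by auto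
qed

text \<open>The objective is half the squared residual norm, and norms are nonnegative, so
  optimality compares the norms themselves.\<close>

lemma arg_min_residual_le:
  assumes "is_arg_min (mf_objective \<Omega> Yh) (mf_feasible m n r k) (U, V)"
    and "mf_feasible m n r k (U0, V0)"
    and Yh: "Yh \<in> carrier_mat m n" and \<Omega>: "\<Omega> \<subseteq> {..<m} \<times> {..<n}"
  shows "L2_set (\<lambda>p. (U * transpose_mat V) $$ p - Yh $$ p) \<Omega>
    \<le> L2_set (\<lambda>p. (U0 * transpose_mat V0) $$ p - Yh $$ p) \<Omega>"
proof -
  have eq: "frob_norm (samp \<Omega> (A * transpose_mat B - Yh)) = L2_set (\<lambda>p. (A * transpose_mat B) $$ p - Yh $$ p) \<Omega>"
    if "mf_feasible m n r k (A, B)" for A B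
  proof -
    have "frob_norm (samp \<Omega> (A * transpose_mat B - Yh)) = L2_set (\<lambda>p. (A * transpose_mat B - Yh) $$ p) \<Omega>"
      using that Yh \<Omega> by (intro frob_norm_samp) (auto simp: mf_feasible_def)
    also have "\<dots> = L2_set (\<lambda>p. (A * transpose_mat B) $$ p - Yh $$ p) \<Omega>"
      using that Yh \<Omega> by (intro L2_set_cong) (auto simp: mf_feasible_def)
    finally show ?thesis .
  qed
  have "mf_objective \<Omega> Yh (U, V) \<le> mf_objective \<Omega> Yh (U0, V0)" and UV: "mf_feasible m n r k (U, V)"
    using assms(1,2) by (auto simp: is_arg_min_def not_less)
  then have "(L2_set (\<lambda>p. (U * transpose_mat V) $$ p - Yh $$ p) \<Omega>)\<^sup>2
      \<le> (L2_set (\<lambda>p. (U0 * transpose_mat V0) $$ p - Yh $$ p) \<Omega>)\<^sup>2"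
    by (simp add: mf_objective_def eq[OF UV] eq[OF assms(2)])
  then show ?thesis by (rule power2_le_imp_le) simp
qed

text \<open>Triangle inequality through the noisy matrix \<open>Y + E\<close>.\<close>

lemma frob_norm_error_le:
  assumes "U \<in> carrier_mat m r" "V \<in> carrier_mat n r" "Y \<in> carrier_mat m n" "E \<in> carrier_mat m n"
  shows "frob_norm (U * transpose_mat V - Y)
    \<le> L2_set (\<lambda>p. (U * transpose_mat V) $$ p - (Y + E) $$ p) ({..<m} \<times> {..<n}) + frob_norm E"
proof -
  let ?I = "{..<m} \<times> {..<n}"
  have "frob_norm (U * transpose_mat V - Y) = L2_set (\<lambda>p. (U * transpose_mat V - Y) $$ p) ?I"
    using assms by (simp add: frob_norm_L2_set)
  also have "\<dots> = L2_set (\<lambda>p. ((U * transpose_mat V) $$ p - (Y + E) $$ p) + E $$ p) ?I"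
    using assms by (intro L2_set_cong) auto
  also have "\<dots> \<le> L2_set (\<lambda>p. (U * transpose_mat V) $$ p - (Y + E) $$ p) ?I + L2_set (\<lambda>p. E $$ p) ?I"
    by (rule L2_set_triangle_ineq)
  also have "L2_set (\<lambda>p. E $$ p) ?I = frob_norm E" using assms by (simp add: frob_norm_L2_set)
  finally show ?thesis .
qed

lemma one_by_one_error_le:
  assumes YE: "Y \<in> carrier_mat 1 1" "E \<in> carrier_mat 1 1" and b: "entries_bounded k (Y + E)"
    and am: "is_arg_min (mf_objective {(0, 0)} (Y + E)) (mf_feasible 1 1 1 k) (U, V)"
  shows "frob_norm (U * transpose_mat V - Y) \<le> frob_norm E"
proof -
  have eq: "(Y + E) * transpose_mat (1\<^sub>m 1) = Y + E" using YE by simp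
  have f0: "mf_feasible 1 1 1 k (Y + E, 1\<^sub>m 1)" using YE b eq by (simp add: mf_feasible_def)
  have "{(0, 0)} = {..<1::nat} \<times> {..<1::nat}" by auto
  then have "L2_set (\<lambda>p. (U * transpose_mat V) $$ p - (Y + E) $$ p) ({..<1} \<times> {..<1})
      \<le> L2_set (\<lambda>p. ((Y + E) * transpose_mat (1\<^sub>m 1)) $$ p - (Y + E) $$ p) {(0, 0)}"
    using arg_min_residual_le[OF am f0] YE by simp
  also have "\<dots> = 0" unfolding eq by simp
  finally show ?thesis
    using frob_norm_error_le[of U 1 1 V 1 Y E] YE am by (auto simp: is_arg_min_def mf_feasible_def)
qed

theorem theorem1:
  shows "\<exists>C::real. C > 0 \<and>
    (\<forall>(r::nat) (m::nat) (n::nat) (s::nat) (k::real) (Y::real mat) (E::real mat).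
       1 \<le> r \<and> r \<le> m \<and> m \<le> n \<and> 1 \<le> s \<and> s \<le> m * n \<and> k > 0 \<and>
       Y \<in> carrier_mat m n \<and> E \<in> carrier_mat m n \<and> vec_space.rank m Y = r \<and>
       entries_bounded k Y \<and> entries_bounded k (Y + E) \<longrightarrow>
       measure_pmf.prob (uniform_samples m n s)
         {\<Omega>. \<forall>U V. is_arg_min (mf_objective \<Omega> (Y + E)) (mf_feasible m n r k) (U, V) \<longrightarrow>
            1 / sqrt (real (m * n)) * frob_norm (U * transpose_mat V - Y)
              \<le> 1 / sqrt (real s) * frob_norm (samp \<Omega> E)
                + frob_norm E / sqrt (real (m * n))
                + C * k * ((real (n * r) * ln (real n)) / real s) powr (1 / 4)}
         \<ge> 1 - 2 * exp (- real n))"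
proof (rule exI[of _ 17], intro conjI allI impI)
  fix r m n s :: nat and k :: real and Y E :: "real mat"
  assume A: "1 \<le> r \<and> r \<le> m \<and> m \<le> n \<and> 1 \<le> s \<and> s \<le> m * n \<and> k > 0 \<and>
       Y \<in> carrier_mat m n \<and> E \<in> carrier_mat m n \<and> vec_space.rank m Y = r \<and>
       entries_bounded k Y \<and> entries_bounded k (Y + E)"
  then have r: "1 \<le> r" "r \<le> m" "m \<le> n" and s: "1 \<le> s" "s \<le> m * n" and k: "k > 0"
    and Y: "Y \<in> carrier_mat m n" and E: "E \<in> carrier_mat m n" and rk: "vec_space.rank m Y = r"
    and bY: "entries_bounded k Y" and bE: "entries_bounded k (Y + E)" by auto
  let ?p = "uniform_samples m n s" and ?I = "{..<m} \<times> {..<n}"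
  let ?q = "(real (n * r) * ln (real n) / real s) powr (1 / 4)"
  let ?concl = "\<lambda>\<Omega> U V. 1 / sqrt (real (m * n)) * frob_norm (U * transpose_mat V - Y)
              \<le> 1 / sqrt (real s) * frob_norm (samp \<Omega> E) + frob_norm E / sqrt (real (m * n)) + 17 * k * ?q"
  let ?am = "\<lambda>\<Omega> U V. is_arg_min (mf_objective \<Omega> (Y + E)) (mf_feasible m n r k) (U, V)"
  let ?P = "{\<Omega>. \<forall>U V. ?am \<Omega> U V \<longrightarrow> ?concl \<Omega> U V}"
  let ?G = "{\<Omega>. \<forall>X\<in>lowrank_bounded m n r k. L2_set (\<lambda>p. X p - (Y + E) $$ p) ?I / sqrt (real (m * n))
       \<le> L2_set (\<lambda>p. X p - (Y + E) $$ p) \<Omega> / sqrt (real s) + 17 * k * ?q}"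
  have F: "frob_norm A \<ge> 0" for A by (simp add: frob_norm_def sum_nonneg)
  show "measure_pmf.prob ?p ?P \<ge> 1 - 2 * exp (- real n)"
  proof (cases "n = 1")
    case True
    then have one: "m = 1" "r = 1" "s = 1" "n = 1" using r s by auto
    have "\<Omega> \<in> ?P" if "\<Omega> \<in> set_pmf ?p" for \<Omega>
    proof (intro CollectI allI impI)
      fix U V assume am: "?am \<Omega> U V"
      have "\<Omega> \<subseteq> {(0, 0)}" "card \<Omega> = 1"
        using that set_pmf_uniform_samples[OF s(2)] one by auto
      then have "\<Omega> = {(0, 0)}" by (metis card.empty subset_singletonD zero_neq_one)
      then have "frob_norm (U * transpose_mat V - Y) \<le> frob_norm E"
        using one_by_one_error_le am Y E bE one by blast
      then show "?concl \<Omega> U V" using F[of "samp \<Omega> E"] one k by simp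
    qed
    then have "measure_pmf.prob ?p ?P = 1" by (subst measure_pmf.prob_eq_1) (auto intro: AE_pmfI)
    then show ?thesis by simp
  next
    case False
    then have n: "2 \<le> n" using r by linarith
    obtain U0 V0 where U0: "U0 \<in> carrier_mat m r" "V0 \<in> carrier_mat n r" "Y = U0 * transpose_mat V0"
      using rank_factorization[OF Y rk] by blast
    have f0: "mf_feasible m n r k (U0, V0)" using U0 bY by (simp add: mf_feasible_def)
    have Z: "\<bar>(Y + E) $$ (i, j)\<bar> \<le> k" if "i < m" "j < n" for i j
      using bE Y E that unfolding entries_bounded_def by auto
    have "\<Omega> \<in> ?P" if \<Omega>: "\<Omega> \<in> set_pmf ?p" "\<Omega> \<in> ?G" for \<Omega>
    proof (intro CollectI allI impI)
      fix U V assume am: "?am \<Omega> U V"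
      then have f: "mf_feasible m n r k (U, V)" by (simp add: is_arg_min_def)
      have \<Omega>I: "\<Omega> \<subseteq> ?I" using \<Omega>(1) set_pmf_uniform_samples[OF s(2)] by auto
      let ?L = "\<lambda>B. L2_set (\<lambda>p. (U * transpose_mat V) $$ p - (Y + E) $$ p) B"
      \<comment> \<open>\<open>Y\<close> is the feasible competitor, and its residual on the sample
        is \<open>- E\<close>.\<close>
      have "?L \<Omega> \<le> L2_set (\<lambda>p. Y $$ p - (Y + E) $$ p) \<Omega>"
        using arg_min_residual_le[OF am f0 _ \<Omega>I] U0(3) Y E by simp
      also have "\<dots> = L2_set (\<lambda>p. - E $$ p) \<Omega>"
        using \<Omega>I Y E by (intro L2_set_cong) auto
      also have "\<dots> = frob_norm (samp \<Omega> E)"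
        using frob_norm_samp[of \<Omega> E] \<Omega>I E by (simp add: L2_set_def)
      finally have 1: "?L \<Omega> / sqrt (real s) \<le> frob_norm (samp \<Omega> E) / sqrt (real s)"
        by (simp add: divide_right_mono)
      have 2: "?L ?I / sqrt (real (m * n)) \<le> ?L \<Omega> / sqrt (real s) + 17 * k * ?q"
        using \<Omega>(2) mf_feasible_lowrank_bounded[OF f] by blast
      have "frob_norm (U * transpose_mat V - Y) \<le> ?L ?I + frob_norm E"
        using f Y E by (intro frob_norm_error_le) (auto simp: mf_feasible_def)
      then have "frob_norm (U * transpose_mat V - Y) / sqrt (real (m * n)) \<le> (?L ?I + frob_norm E) / sqrt (real (m * n))"
        by (rule divide_right_mono) simp
      then show "?concl \<Omega> U V" using 1 2 by (simp only: add_divide_distrib times_divide_eq_left mult_1)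
    qed
    then have sub: "?G \<inter> set_pmf ?p \<subseteq> ?P" by blast
    \<comment> \<open>Only the uniform deviation can fail, so a single \<open>exp (- real n)\<close>
      is lost, which is stronger than the claimed bound.\<close>
    have "1 - exp (- real n) \<le> measure_pmf.prob ?p ?G"
      using lowrank_uniform_deviation[OF r n s k, of "\<lambda>p. (Y + E) $$ p"] Z by simp
    also have "\<dots> = measure_pmf.prob ?p (?G \<inter> set_pmf ?p)" by (simp add: measure_Int_set_pmf)
    also have "\<dots> \<le> measure_pmf.prob ?p ?P" using sub by (intro measure_pmf.finite_measure_mono) auto
    finally show ?thesis using exp_gt_zero[of "- real n"] by linarith
  qed
qed simp

end
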